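(* Let $L(q,\dot q):\mathsf{T}(\mathsf{S}^2)^n\to\mathbb{R}$ be a Lagrangian for a mechanical system evolving on the product $(\mathsf{S}^2)^n$ of $n$ two-spheres, with generalized force $f_i\in\mathbb{R}^3$ acting on $q_i$, $i=1,\dots,n$. The Euler--Lagrange equations are $$\left(I_3-q_iq_i^T\right)\left\{\frac{d}{dt}\left(\frac{\partial L(q,\dot q)}{\partial \dot q_i}\right)-\frac{\partial L(q,\dot q)}{\partial q_i}-f_i\right\}=0,\qquad i\in\{1,\dots,n\}.$$ That is, a curve $q=(q_1,\dots,q_n):[t_0,t_f]\to(\mathsf{S}^2)^n$ satisfies the Lagrange--d'Alembert principle $\delta\mathfrak{G}=-\delta\mathcal{W}$ for all admissible variations if and only if these equations hold along $q$.
   Context: $\mathsf{S}^2=\{q\in\mathbb{R}^3:\|q\|=1\}$, $\mathsf{T}_q\mathsf{S}^2=\{\xi\in\mathbb{R}^3: q\cdot\xi=0\}$, $x\cdot y=x^Ty$, and $I_3$ is the $3\times3$ identity matrix. $S(x)$ is the skew-symmetric $3\times 3$ matrix with $S(x)y=x\times y$. All functions and curves are assumed sufficiently smooth (curves $q$ of class $C^2$). Functions on $\mathsf{T}(\mathsf{S}^2)^n\subset\mathbb{R}^{3n}\times\mathbb{R}^{3n}$ are regarded as (restrictions of) smooth functions on an open neighborhood in the ambient space, and $\partial L/\partial q_i,\ \partial L/\partial\dot q_i\in\mathbb{R}^3$ are the ordinary gradients there. Admissible variations: $q_i^\epsilon(t)=e^{\epsilon S(\gamma_i(t))}q_i(t)$,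 where $\gamma_i:[t_0,t_f]\to\mathbb{R}^3$ is a continuously differentiable curve with $\gamma_i(t_0)=\gamma_i(t_f)=0$ and $\gamma_i(t)\cdot q_i(t)=0$ for all $t$. The infinitesimal variations are $\delta q_i=S(\gamma_i)q_i$ and $\delta\dot q_i=S(\dot\gamma_i)q_i+S(\gamma_i)\dot q_i$. The action integral is $\mathfrak{G}=\int_{t_0}^{t_f}L(q,\dot q)\,dt$, with $\delta\mathfrak{G}=\frac{d}{d\epsilon}\big|_{\epsilon=0}\int_{t_0}^{t_f}L(q^\epsilon,\dot q^\epsilon)\,dt$. The virtual work of the generalized forces (given continuous $\mathbb{R}^3$-valued functions along the motion) is $\sum_i f_i\cdot\delta q_i$, and $\delta\mathcal{W}$ in the principle denotes its time integral $\int_{t_0}^{t_f}\sum_{i=1}^n f_i\cdot\delta q_i\,dt$. The Euler--Lagrange equations are the equations characterizing the curves that satisfy the Lagrange--d'Alembert principle $\delta\mathfrak{G}=-\delta\mathcal{W}$ for all admissible variations. *)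

theory Defs
  imports "HOL-Analysis.Analysis"
begin

definition spheres :: "(real^3^'n) set" where
  "spheres = {q. \<forall>i. q $ i \<in> sphere 0 1}"

definition tangent_spheres :: "((real^3^'n) \<times> (real^3^'n)) set" where
  "tangent_spheres = {(q, v). q \<in> spheres \<and> (\<forall>i. q $ i \<bullet> v $ i = 0)}"

definition C2_on :: "'a::real_normed_vector set \<Rightarrow> ('a \<Rightarrow> real) \<Rightarrow> bool" where
  "C2_on U L \<longleftrightarrow>
     (\<exists>(DL :: 'a \<Rightarrow> 'a \<Rightarrow>\<^sub>L real) (D2L :: 'a \<Rightarrow> 'a \<Rightarrow>\<^sub>L 'a \<Rightarrow>\<^sub>L real).
        (\<forall>x\<in>U. (L has_derivative blinfun_apply (DL x)) (at x)) \<and>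
        (\<forall>x\<in>U. (DL has_derivative blinfun_apply (D2L x)) (at x)) \<and>
        continuous_on U D2L)"

text \<open>
  Curves live on a closed interval \<open>I\<close>, so time derivatives are taken within \<open>I\<close>: they are
  one-sided at the end points and do not depend on the values of the curve outside \<open>I\<close>.
\<close>

definition ddt :: "real set \<Rightarrow> (real \<Rightarrow> 'a::real_normed_vector) \<Rightarrow> real \<Rightarrow> 'a" where
  "ddt I c t = vector_derivative c (at t within I)"

definition C1_curve :: "real set \<Rightarrow> (real \<Rightarrow> 'a::real_normed_vector) \<Rightarrow> bool" where
  "C1_curve I c \<longleftrightarrow>
     (\<forall>t\<in>I. c differentiable (at t within I)) \<and> continuous_on I (ddt I c)"

definition C2_curve :: "real set \<Rightarrow> (real \<Rightarrow> 'a::real_normed_vector) \<Rightarrow> bool" where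
  "C2_curve I c \<longleftrightarrow> C1_curve I c \<and> C1_curve I (ddt I c)"

definition gradient :: "('a::real_inner \<Rightarrow> real) \<Rightarrow> 'a \<Rightarrow> 'a" where
  "gradient f x = (THE D. GDERIV f x :> D)"

definition vec_upd :: "'a^'n \<Rightarrow> 'n \<Rightarrow> 'a \<Rightarrow> 'a^'n" where
  "vec_upd q i x = (\<chi> j. if j = i then x else q $ j)"

definition grad_q ::
  "((real^3^'n) \<times> (real^3^'n) \<Rightarrow> real) \<Rightarrow> 'n \<Rightarrow> real^3^'n \<Rightarrow> real^3^'n \<Rightarrow> real^3" where
  "grad_q L i q v = gradient (\<lambda>x. L (vec_upd q i x, v)) (q $ i)"

definition grad_v ::
  "((real^3^'n) \<times> (real^3^'n) \<Rightarrow> real) \<Rightarrow> 'n \<Rightarrow> real^3^'n \<Rightarrow> real^3^'n \<Rightarrow> real^3" where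
  "grad_v L i q v = gradient (\<lambda>x. L (q, vec_upd v i x)) (v $ i)"

definition skew :: "real^3 \<Rightarrow> real^3^3" where
  "skew x = matrix (cross3 x)"

lemma skew_mult_vec: "skew x *v y = cross3 x y"
  unfolding skew_def
  using bilinear_cross[unfolded bilinear_def]
  by (intro matrix_works) (simp add: linear_def scalar_mult_eq_scaleR[abs_def])

text \<open>
  The row of \<open>columnvector\<close> and the column of \<open>rowvector\<close> may have any length; it has to be
  fixed to \<open>1\<close> for their product to be the outer product of a vector with itself.
\<close>

definition outer_square :: "real^3 \<Rightarrow> real^3^3" where
  "outer_square x = (columnvector x :: real^1^3) ** (rowvector x :: real^3^1)"

definition matrix_exp :: "real^'m^'m \<Rightarrow> real^'m^'m" where
  "matrix_exp A = (\<Sum>k. ((**) A ^^ k) (mat 1) /\<^sub>R fact k)"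

definition variation ::
  "(real \<Rightarrow> real^3^'n) \<Rightarrow> (real \<Rightarrow> real^3^'n) \<Rightarrow> real \<Rightarrow> real \<Rightarrow> real^3^'n" where
  "variation q \<gamma> \<epsilon> t = (\<chi> i. matrix_exp (\<epsilon> *\<^sub>R skew (\<gamma> t $ i)) *v (q t $ i))"

definition admissible ::
  "real \<Rightarrow> real \<Rightarrow> (real \<Rightarrow> real^3^'n) \<Rightarrow> (real \<Rightarrow> real^3^'n) \<Rightarrow> bool" where
  "admissible t0 tf q \<gamma> \<longleftrightarrow>
     C1_curve {t0..tf} \<gamma> \<and> \<gamma> t0 = 0 \<and> \<gamma> tf = 0 \<and>
     (\<forall>t\<in>{t0..tf}. \<forall>i. \<gamma> t $ i \<bullet> q t $ i = 0)"

definition action ::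
  "real \<Rightarrow> real \<Rightarrow> ((real^3^'n) \<times> (real^3^'n) \<Rightarrow> real) \<Rightarrow> (real \<Rightarrow> real^3^'n) \<Rightarrow> real" where
  "action t0 tf L q = integral {t0..tf} (\<lambda>t. L (q t, ddt {t0..tf} q t))"

definition virtual_work ::
  "real \<Rightarrow> real \<Rightarrow> (real \<Rightarrow> real^3^'n) \<Rightarrow> (real \<Rightarrow> real^3^'n) \<Rightarrow> (real \<Rightarrow> real^3^'n) \<Rightarrow> real" where
  "virtual_work t0 tf f q \<gamma> =
     integral {t0..tf} (\<lambda>t. \<Sum>i\<in>UNIV. f t $ i \<bullet> (skew (\<gamma> t $ i) *v (q t $ i)))"

definition lagrange_dalembert ::
  "real \<Rightarrow> real \<Rightarrow> ((real^3^'n) \<times> (real^3^'n) \<Rightarrow> real) \<Rightarrow>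
   (real \<Rightarrow> real^3^'n) \<Rightarrow> (real \<Rightarrow> real^3^'n) \<Rightarrow> bool" where
  "lagrange_dalembert t0 tf L f q \<longleftrightarrow>
     (\<forall>\<gamma>. admissible t0 tf q \<gamma> \<longrightarrow>
        ((\<lambda>\<epsilon>. action t0 tf L (variation q \<gamma> \<epsilon>))
           has_real_derivative - virtual_work t0 tf f q \<gamma>) (at 0))"

end

theory Submission
  imports Defs
begin

text \<open>
  Write \<open>v = q'\<close>, \<open>P\<^sub>i = \<partial>L/\<partial>v\<^sub>i\<close>, \<open>Q\<^sub>i = \<partial>L/\<partial>q\<^sub>i\<close> and \<open>E\<^sub>i = P\<^sub>i' - Q\<^sub>i - f\<^sub>i\<close> along the curve. The rotations
  \<open>exp (\<epsilon> S(\<gamma>\<^sub>i))\<close> about axes orthogonal to \<open>q\<^sub>i\<close> are given by Rodrigues' formula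
  (\<open>matrix_exp_skew_mult_orthogonal\<close>), which shows that a variation is regular enough in \<open>\<epsilon>\<close> and \<open>t\<close> for
  differentiation under the integral sign and that \<open>\<delta>q\<^sub>i = \<gamma>\<^sub>i \<times> q\<^sub>i\<close>. After an integration by parts
  (\<open>first_variation\<close>) the derivative of the action is \<open>- \<integral> \<Sum>\<^sub>i (P\<^sub>i' - Q\<^sub>i) \<bullet> (\<gamma>\<^sub>i \<times> q\<^sub>i)\<close>, so the
  Lagrange--d'Alembert principle for \<open>\<gamma>\<close> says that \<open>\<integral> \<Sum>\<^sub>i E\<^sub>i \<bullet> (\<gamma>\<^sub>i \<times> q\<^sub>i)\<close> vanishes, which is
  \<open>\<integral> \<Sum>\<^sub>i \<gamma>\<^sub>i \<bullet> (q\<^sub>i \<times> E\<^sub>i) = 0\<close>.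

  If \<open>q\<^sub>i \<times> E\<^sub>i = 0\<close> for all \<open>i\<close>, this holds for every \<open>\<gamma>\<close>. Conversely, insert
  \<open>\<gamma>\<^sub>i = \<phi> (c - (q\<^sub>i \<bullet> c) q\<^sub>i)\<close> for a fixed vector \<open>c\<close> and a scalar function \<open>\<phi>\<close> vanishing at the end
  points (\<open>admissible_single_sphere\<close>): the integral becomes \<open>\<integral> \<phi> (c \<bullet> (q\<^sub>i \<times> E\<^sub>i))\<close>, and the
  fundamental lemma of the calculus of variations (\<open>fundamental_lemma_of_variations\<close>) gives
  \<open>c \<bullet> (q\<^sub>i \<times> E\<^sub>i) = 0\<close>. As \<open>q\<^sub>i\<close> is a unit vector, \<open>q\<^sub>i \<times> E\<^sub>i = 0\<close> means that the projection of \<open>E\<^sub>i\<close>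
  to the tangent plane vanishes (\<open>tangential_projection_eq_0_iff\<close>).
\<close>

section \<open>Rotations of a point about a perpendicular axis\<close>

text \<open>
  The entire functions with \<open>cos_root (y\<^sup>2) = cos y\<close> and \<open>y * sinc_root (y\<^sup>2) = sin y\<close>. Rodrigues'
  formula contains \<open>cos (\<epsilon> * norm \<gamma>)\<close> and \<open>sin (\<epsilon> * norm \<gamma>) / norm \<gamma>\<close>; written with these
  functions of \<open>\<epsilon>\<^sup>2 * (norm \<gamma>)\<^sup>2\<close>, it is visibly smooth also where \<open>\<gamma>\<close> vanishes and the norm is not
  differentiable.
\<close>

definition cos_root :: "real \<Rightarrow> real" where
  "cos_root x = (\<Sum>n. (-1) ^ n / fact (2 * n) * x ^ n)"

definition sinc_root_coeff :: "nat \<Rightarrow> real" where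
  "sinc_root_coeff n = (-1) ^ n / fact (2 * n + 1)"

text \<open>
  All derivatives of \<open>sinc_root\<close> at once: derivatives up to the second occur in the mixed derivative
  of a variation.
\<close>

definition sinc_root_deriv :: "nat \<Rightarrow> real \<Rightarrow> real" where
  "sinc_root_deriv k x = (\<Sum>n. (diffs ^^ k) sinc_root_coeff n * x ^ n)"

abbreviation "sinc_root \<equiv> sinc_root_deriv 0"

lemma summable_powser_of_fact_bound:
  fixes c :: "nat \<Rightarrow> real"
  assumes "\<And>n. \<bar>c n\<bar> \<le> 1 / fact n"
  shows "summable (\<lambda>n. c n * x ^ n)"
proof (rule summable_comparison_test')
  show "summable (\<lambda>n. \<bar>x\<bar> ^ n / fact n)"
    using summable_exp[of "\<bar>x\<bar>"] by (simp add: field_simps)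
  show "norm (c n * x ^ n) \<le> \<bar>x\<bar> ^ n / fact n" if "n \<ge> 0" for n
    using mult_right_mono[OF assms[of n], of "\<bar>x\<bar> ^ n"] by (simp add: abs_mult power_abs)
qed

lemma summable_cos_root: "summable (\<lambda>n. (-1) ^ n / fact (2 * n) * (x :: real) ^ n)"
  by (rule summable_powser_of_fact_bound) (simp add: power_abs frac_le fact_mono)

lemma summable_sinc_root_deriv: "summable (\<lambda>n. (diffs ^^ k) sinc_root_coeff n * x ^ n)"
proof (induction k arbitrary: x)
  case 0
  have "\<bar>sinc_root_coeff n\<bar> \<le> 1 / fact n" for n
    unfolding sinc_root_coeff_def
    by (simp add: power_abs del: fact_Suc) (intro frac_le, auto intro!: fact_mono simp del: fact_Suc)
  then show ?case by (simp add: summable_powser_of_fact_bound)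
next
  case (Suc k)
  then show ?case by (simp add: termdiff_converges_all)
qed

lemma sinc_root_deriv_has_real_derivative:
  "(sinc_root_deriv k has_real_derivative sinc_root_deriv (Suc k) x) (at x)"
  using termdiffs_strong_converges_everywhere[OF summable_sinc_root_deriv, of k x]
  unfolding sinc_root_deriv_def[abs_def] by simp

lemma cos_root_has_real_derivative:
  "(cos_root has_real_derivative - sinc_root x / 2) (at x)"
proof -
  have "diffs (\<lambda>n. (-1) ^ n / fact (2 * n)) n = - (sinc_root_coeff n / 2)" for n
  proof -
    have "fact (2 * Suc n) = 2 * real (Suc n) * (fact (2 * n + 1) :: real)"
      by (simp add: algebra_simps)
    then show ?thesis
      by (simp add: diffs_def sinc_root_coeff_def del: fact_Suc mult_Suc_right of_nat_Suc)
  qed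
  then have "(\<Sum>n. diffs (\<lambda>n. (-1) ^ n / fact (2 * n)) n * x ^ n)
      = (\<Sum>n. (- (1 / 2)) * (sinc_root_coeff n * x ^ n))"
    by simp
  also have "\<dots> = - sinc_root x / 2"
    using suminf_mult[OF summable_sinc_root_deriv[of 0 x], of "- (1 / 2)"]
    by (simp add: sinc_root_deriv_def)
  finally show ?thesis
    using termdiffs_strong_converges_everywhere[of "\<lambda>n. (-1) ^ n / fact (2 * n)" x, OF summable_cos_root]
    unfolding cos_root_def[abs_def] by simp
qed

lemma cos_root_sums: "(\<lambda>n. (-1) ^ n / fact (2 * n) * x ^ n) sums cos_root x"
  unfolding cos_root_def by (rule summable_sums[OF summable_cos_root])

lemma sinc_root_sums: "(\<lambda>n. sinc_root_coeff n * x ^ n) sums sinc_root x"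
  using summable_sums[OF summable_sinc_root_deriv[of 0 x]] by (simp add: sinc_root_deriv_def)

lemma cos_root_square: "cos_root (y\<^sup>2) = cos y"
  using sums_unique2[OF cos_root_sums[of "y\<^sup>2"]] cos_paired[of y] by (simp add: power_mult)

lemma sinc_root_square: "y * sinc_root (y\<^sup>2) = sin y"
proof -
  have "(\<lambda>n. y * (sinc_root_coeff n * (y\<^sup>2) ^ n)) sums (y * sinc_root (y\<^sup>2))"
    by (intro sums_mult sinc_root_sums)
  then have "(\<lambda>n. (-1) ^ n / fact (2 * n + 1) * y ^ (2 * n + 1)) sums (y * sinc_root (y\<^sup>2))"
    by (simp add: sinc_root_coeff_def power_mult power2_eq_square power_mult_distrib mult_ac del: fact_Suc)
  then show ?thesis using sin_paired[of y] by (rule sums_unique2)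
qed

lemma bounded_bilinear_matrix_mult:
  "bounded_bilinear ((**) :: real^'m^'m \<Rightarrow> real^'m^'m \<Rightarrow> real^'m^'m)"
  unfolding bilinear_conv_bounded_bilinear[symmetric] bilinear_def linear_iff
proof (intro conjI allI)
  fix A B :: "real^'m^'m" and c :: real
  show "A ** (c *\<^sub>R B) = c *\<^sub>R (A ** B)" and "(c *\<^sub>R A) ** B = c *\<^sub>R (A ** B)"
    by (simp_all add: vec_eq_iff matrix_matrix_mult_def sum_distrib_left mult.left_commute mult.assoc)
  show "(A + B) ** C = A ** C + B ** C" for C :: "real^'m^'m"
    by (simp add: vec_eq_iff matrix_matrix_mult_def distrib_right sum.distrib)
qed (simp_all add: matrix_add_ldistrib)

lemma summable_matrix_exp:
  fixes A :: "real^'m^'m"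
  shows "summable (\<lambda>k. ((**) A ^^ k) (mat 1) /\<^sub>R fact k)"
proof -
  obtain K where K: "K > 0" "\<And>(X :: real^'m^'m) (Y :: real^'m^'m). norm (X ** Y) \<le> norm X * norm Y * K"
    using bounded_bilinear.pos_bounded[OF bounded_bilinear_matrix_mult] by blast
  have bound: "norm (((**) A ^^ k) (mat 1)) \<le> (norm A * K) ^ k * norm (mat 1 :: real^'m^'m)" for k
  proof (induction k)
    case (Suc k)
    have "norm (((**) A ^^ Suc k) (mat 1)) \<le> norm A * norm (((**) A ^^ k) (mat 1)) * K"
      using K(2) by simp
    also have "\<dots> \<le> norm A * ((norm A * K) ^ k * norm (mat 1 :: real^'m^'m)) * K"
      using Suc K(1) by (intro mult_right_mono mult_left_mono) auto
    finally show ?case by (simp add: mult_ac)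
  qed simp
  show ?thesis
  proof (rule summable_comparison_test')
    show "summable (\<lambda>k. (inverse (fact k) * (norm A * K) ^ k) * norm (mat 1 :: real^'m^'m))"
      by (intro summable_mult2 summable_exp)
    show "norm (((**) A ^^ k) (mat 1) /\<^sub>R fact k)
        \<le> inverse (fact k) * (norm A * K) ^ k * norm (mat 1 :: real^'m^'m)" if "k \<ge> 0" for k
      using mult_left_mono[OF bound[of k], of "inverse (fact k)"] by (simp add: mult_ac)
  qed
qed

lemma matrix_exp_mult_vec_sums:
  fixes A :: "real^'m^'m"
  shows "(\<lambda>k. ((*v) A ^^ k) x /\<^sub>R fact k) sums (matrix_exp A *v x)"
proof -
  have lin: "bounded_linear (\<lambda>B :: real^'m^'m. B *v x)"
    unfolding linear_conv_bounded_linear[symmetric] linear_iff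
    by (simp add: matrix_vector_mult_add_rdistrib scaleR_matrix_vector_assoc)
  have "((**) A ^^ k) (mat 1) *v x = ((*v) A ^^ k) x" for k
    by (induction k) (simp_all add: matrix_vector_mul_assoc[symmetric])
  then show ?thesis
    using bounded_linear.sums[OF lin summable_sums[OF summable_matrix_exp[of A]]]
    by (simp add: matrix_exp_def scaleR_matrix_vector_assoc[symmetric])
qed

lemma cross3_cross3_orthogonal:
  fixes g q :: "real^3"
  assumes "g \<bullet> q = 0"
  shows "cross3 g (cross3 g q) = - (norm g)\<^sup>2 *\<^sub>R q"
  using assms Lagrange[of g g q] by (simp add: power2_norm_eq_inner)

text \<open>
  Rodrigues' formula. For \<open>g\<close> orthogonal to \<open>q\<close>, applying \<open>skew g\<close> twice multiplies \<open>q\<close> by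
  \<open>- (norm g)\<^sup>2\<close>. Hence the even terms of the exponential series are multiples of \<open>q\<close> and the odd
  ones multiples of \<open>cross3 g q\<close>, and summing them in pairs gives the two power series.
\<close>

lemma matrix_exp_skew_mult_orthogonal:
  fixes g q :: "real^3"
  assumes "g \<bullet> q = 0"
  defines "s \<equiv> (norm g)\<^sup>2"
  shows "matrix_exp (\<epsilon> *\<^sub>R skew g) *v q
    = cos_root (\<epsilon>\<^sup>2 * s) *\<^sub>R q + (\<epsilon> * sinc_root (\<epsilon>\<^sup>2 * s)) *\<^sub>R cross3 g q"
proof -
  define A where "A = \<epsilon> *\<^sub>R skew g"
  define a where "a k = ((*v) A ^^ k) q /\<^sub>R fact k" for k
  have A: "A *v x = \<epsilon> *\<^sub>R cross3 g x" for x
    by (simp add: A_def scaleR_matrix_vector_assoc[symmetric] skew_mult_vec)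
  have even: "((*v) A ^^ (n * 2)) q = (- (\<epsilon>\<^sup>2 * s)) ^ n *\<^sub>R q" for n
  proof (induction n)
    case (Suc n)
    then show ?case
      by (simp add: A cross_mult_right cross3_cross3_orthogonal[OF assms(1)] s_def power2_eq_square mult_ac)
  qed simp
  have pair: "sum a {n * 2..<n * 2 + 2}
      = ((-1) ^ n / fact (2 * n) * (\<epsilon>\<^sup>2 * s) ^ n) *\<^sub>R q
        + (sinc_root_coeff n * (\<epsilon>\<^sup>2 * s) ^ n) *\<^sub>R \<epsilon> *\<^sub>R cross3 g q" for n
  proof -
    have "{n * 2..<n * 2 + 2} = {n * 2, Suc (n * 2)}" by auto
    then have "sum a {n * 2..<n * 2 + 2} = a (n * 2) + a (Suc (n * 2))" by simp
    then show ?thesis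
      using power_minus[of "\<epsilon>\<^sup>2 * s" n] even[of n]
      by (simp add: a_def A cross_mult_right sinc_root_coeff_def divide_inverse mult_ac del: fact_Suc)
  qed
  have "(\<lambda>n. sum a {n * 2..<n * 2 + 2}) sums (matrix_exp A *v q)"
    using sums_group[OF matrix_exp_mult_vec_sums[of A q], of 2] by (simp add: a_def)
  moreover have "(\<lambda>n. sum a {n * 2..<n * 2 + 2}) sums
      (cos_root (\<epsilon>\<^sup>2 * s) *\<^sub>R q + sinc_root (\<epsilon>\<^sup>2 * s) *\<^sub>R \<epsilon> *\<^sub>R cross3 g q)"
    unfolding pair by (intro sums_add sums_scaleR_left cos_root_sums sinc_root_sums)
  ultimately have "matrix_exp A *v q
      = cos_root (\<epsilon>\<^sup>2 * s) *\<^sub>R q + sinc_root (\<epsilon>\<^sup>2 * s) *\<^sub>R \<epsilon> *\<^sub>R cross3 g q"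
    by (rule sums_unique2)
  then show ?thesis by (simp add: A_def mult_ac)
qed

text \<open>
  By Rodrigues' formula the image is a combination of the orthogonal vectors \<open>q\<close> and \<open>cross3 g q\<close>,
  so the claim reduces to \<open>cos\<^sup>2 + sin\<^sup>2 = 1\<close>.
\<close>

lemma norm_rotation:
  fixes g q :: "real^3"
  assumes "g \<bullet> q = 0" and "norm q = 1"
  shows "norm (matrix_exp (\<epsilon> *\<^sub>R skew g) *v q) = 1"
proof -
  let ?y = "\<epsilon> * norm g"
  have y: "\<epsilon>\<^sup>2 * (norm g)\<^sup>2 = ?y\<^sup>2" by (simp add: power_mult_distrib)
  have cross: "(norm (cross3 g q))\<^sup>2 = (norm g)\<^sup>2"
    using norm_cross_dot[of g q] assms by simp
  have "(norm (matrix_exp (\<epsilon> *\<^sub>R skew g) *v q))\<^sup>2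
      = (cos_root (?y\<^sup>2))\<^sup>2 + (\<epsilon> * sinc_root (?y\<^sup>2))\<^sup>2 * (norm g)\<^sup>2"
    unfolding matrix_exp_skew_mult_orthogonal[OF assms(1)] y
    by (subst norm_add_Pythagorean)
      (use assms(2) cross in \<open>simp_all add: orthogonal_def dot_cross_self power_mult_distrib\<close>)
  also have "\<dots> = (cos ?y)\<^sup>2 + (sin ?y)\<^sup>2"
    unfolding cos_root_square sinc_root_square[of ?y, symmetric]
    by (simp add: power_mult_distrib mult_ac)
  finally show ?thesis by (simp add: abs_square_eq_1)
qed

section \<open>The variation of a curve\<close>

lemma bounded_linear_axis: "bounded_linear (axis i :: real^3 \<Rightarrow> real^3^'n)"
  unfolding linear_conv_bounded_linear[symmetric] linear_iff by (simp add: vec_eq_iff axis_def)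

lemma sum_axis_eq: "(\<Sum>i\<in>UNIV. axis i (x $ i)) = (x :: real^3^'n)"
  by (simp add: vec_eq_iff axis_def if_distrib[of "\<lambda>x. x $ _"] cong: if_cong)

lemma has_vector_derivative_componentwise:
  fixes c :: "real \<Rightarrow> real^3^'n"
  assumes "\<And>i. ((\<lambda>t. c t $ i) has_vector_derivative c' $ i) F"
  shows "(c has_vector_derivative c') F"
proof -
  have "((\<lambda>t. \<Sum>i\<in>UNIV. axis i (c t $ i)) has_vector_derivative (\<Sum>i\<in>UNIV. axis i (c' $ i))) F"
    by (intro has_vector_derivative_sum bounded_linear.has_vector_derivative[OF bounded_linear_axis] assms)
  then show ?thesis by (simp add: sum_axis_eq)
qed

lemma bounded_bilinear_cross3: "bounded_bilinear cross3"
  using bilinear_cross bilinear_conv_bounded_bilinear by blast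

lemmas has_vector_derivative_cross3 =
  bounded_bilinear.has_vector_derivative[OF bounded_bilinear_cross3]

text \<open>
  Differentiate \<open>c t $ i \<bullet> c t $ i = 1\<close>. Because varied curves stay on the spheres, they and their
  velocities then remain in the domain of the Lagrangian for every \<open>\<epsilon>\<close>, not only for small ones.
\<close>

lemma tangent_spheresI:
  fixes c :: "real \<Rightarrow> real^3^'n"
  assumes "a < b" and sphere: "\<And>s. s \<in> {a..b} \<Longrightarrow> c s \<in> spheres"
    and deriv: "(c has_vector_derivative c') (at t within {a..b})" and "t \<in> {a..b}"
  shows "(c t, c') \<in> tangent_spheres"
proof -
  have "c t $ i \<bullet> c' $ i = 0" for i
  proof -
    have "((\<lambda>s. c s $ i) has_vector_derivative c' $ i) (at t within {a..b})"
      by (rule bounded_linear.has_vector_derivative[OF bounded_linear_vec_nth deriv])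
    from bounded_bilinear.has_vector_derivative[OF bounded_bilinear_inner this this]
    have "((\<lambda>s. c s $ i \<bullet> c s $ i) has_vector_derivative 2 * (c t $ i \<bullet> c' $ i)) (at t within {a..b})"
      by (simp add: inner_commute)
    moreover have "((\<lambda>s. c s $ i \<bullet> c s $ i) has_vector_derivative 0) (at t within {a..b})"
    proof (rule has_vector_derivative_transform[OF \<open>t \<in> {a..b}\<close>])
      show "c s $ i \<bullet> c s $ i = 1" if "s \<in> {a..b}" for s
        using sphere[OF that] by (simp add: spheres_def norm_eq_1)
    qed simp
    ultimately show ?thesis
      using vector_derivative_unique_within_closed_interval[of a b t] assms(1,4) by fastforce
  qed
  then show ?thesis using sphere[OF \<open>t \<in> {a..b}\<close>] by (simp add: tangent_spheres_def)
qed

lemma ddt_eqI: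
  assumes "a < b" "t \<in> {a..b}" "(c has_vector_derivative c') (at t within {a..b})"
  shows "ddt {a..b} c t = c'"
  using vector_derivative_within_cbox[of a b t] assms unfolding ddt_def by simp

lemma C1_curve_derivative:
  assumes "C1_curve I c" and "t \<in> I"
  shows "(c has_vector_derivative ddt I c t) (at t within I)"
  using assms by (simp add: C1_curve_def ddt_def vector_derivative_works)

lemma C1_curve_component_derivative:
  fixes c :: "real \<Rightarrow> real^3^'n"
  assumes "C1_curve I c" and "t \<in> I"
  shows "((\<lambda>t. c t $ i) has_vector_derivative ddt I c t $ i) (at t within I)"
  by (rule bounded_linear.has_vector_derivative[OF bounded_linear_vec_nth C1_curve_derivative[OF assms]])

lemma C1_curve_continuous: "C1_curve I c \<Longrightarrow> continuous_on I c"
  by (auto simp: C1_curve_def continuous_on_eq_continuous_within differentiable_imp_continuous_within)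

lemma C1_curveI:
  assumes "a < b" "\<And>t. t \<in> {a..b} \<Longrightarrow> (c has_vector_derivative c' t) (at t within {a..b})"
    "continuous_on {a..b} c'"
  shows "C1_curve {a..b} c"
proof -
  have "ddt {a..b} c t = c' t" if "t \<in> {a..b}" for t
    using ddt_eqI assms(1,2) that by blast
  then have "continuous_on {a..b} (ddt {a..b} c)"
    using assms(3) by (metis continuous_on_eq)
  then show ?thesis
    using assms(2) unfolding C1_curve_def differentiable_def has_vector_derivative_def by blast
qed

text \<open>
  The regularity of a family of curves \<open>u \<epsilon>\<close> that permits differentiating an action under the
  integral sign: \<open>ut\<close>, \<open>ue\<close> and \<open>uet\<close> are \<open>\<partial>u/\<partial>t\<close>, \<open>\<partial>u/\<partial>\<epsilon>\<close> and \<open>\<partial>\<^sup>2u/\<partial>\<epsilon>\<partial>t\<close>, all jointly continuous.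
\<close>

definition C1_variation :: "real set \<Rightarrow> (real \<Rightarrow> real \<Rightarrow> 'a::real_normed_vector) \<Rightarrow>
    (real \<Rightarrow> real \<Rightarrow> 'a) \<Rightarrow> (real \<Rightarrow> real \<Rightarrow> 'a) \<Rightarrow> (real \<Rightarrow> real \<Rightarrow> 'a) \<Rightarrow> bool" where
  "C1_variation I u ut ue uet \<longleftrightarrow>
    (\<forall>\<epsilon>. \<forall>t\<in>I. ((\<lambda>s. u \<epsilon> s) has_vector_derivative ut \<epsilon> t) (at t within I) \<and>
       ((\<lambda>\<epsilon>. u \<epsilon> t) has_vector_derivative ue \<epsilon> t) (at \<epsilon>) \<and>
       ((\<lambda>\<epsilon>. ut \<epsilon> t) has_vector_derivative uet \<epsilon> t) (at \<epsilon>)) \<and>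
    (\<forall>h\<in>{u, ut, ue, uet}. continuous_on (UNIV \<times> I) (\<lambda>(\<epsilon>, t). h \<epsilon> t))"

lemma C1_variation_vec:
  fixes u :: "real \<Rightarrow> real \<Rightarrow> real^3^'n"
  assumes "\<And>i. C1_variation I (\<lambda>\<epsilon> t. u \<epsilon> t $ i) (\<lambda>\<epsilon> t. ut \<epsilon> t $ i) (\<lambda>\<epsilon> t. ue \<epsilon> t $ i) (\<lambda>\<epsilon> t. uet \<epsilon> t $ i)"
  shows "C1_variation I u ut ue uet"
proof -
  have cont: "continuous_on (UNIV \<times> I) (\<lambda>(\<epsilon>, t). h \<epsilon> t)"
    if "\<And>i. continuous_on (UNIV \<times> I) (\<lambda>(\<epsilon>, t). h \<epsilon> t $ i)" for h :: "real \<Rightarrow> real \<Rightarrow> real^3^'n"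
    using continuous_on_vec_lambda[of "UNIV \<times> I" "\<lambda>i z. h (fst z) (snd z) $ i"] that
    by (simp add: split_beta)
  show ?thesis
    using assms unfolding C1_variation_def
    by (auto intro!: has_vector_derivative_componentwise cont)
qed

text \<open>
  Rodrigues' formula expresses the family as a combination of \<open>q\<close> and \<open>cross3 g q\<close> whose coefficients
  are smooth functions of \<open>\<epsilon>\<close> and \<open>(norm g)\<^sup>2\<close>; the partial derivatives are then computed by the
  product and chain rules. At \<open>\<epsilon> = 0\<close> they are the infinitesimal variations of position and velocity.
\<close>

lemma rotation_variation:
  fixes q g q' g' :: "real \<Rightarrow> real^3"
  assumes orth: "\<And>t. t \<in> I \<Longrightarrow> g t \<bullet> q t = 0"
    and q': "\<And>t. t \<in> I \<Longrightarrow> (q has_vector_derivative q' t) (at t within I)"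
    and g': "\<And>t. t \<in> I \<Longrightarrow> (g has_vector_derivative g' t) (at t within I)"
    and cont: "continuous_on I q" "continuous_on I g" "continuous_on I q'" "continuous_on I g'"
  defines "u \<equiv> \<lambda>\<epsilon> t. matrix_exp (\<epsilon> *\<^sub>R skew (g t)) *v q t"
  shows "\<exists>ut ue uet. C1_variation I u ut ue uet \<and>
    (\<forall>t\<in>I. u 0 t = q t \<and> ut 0 t = q' t \<and> ue 0 t = cross3 (g t) (q t) \<and>
      uet 0 t = cross3 (g' t) (q t) + cross3 (g t) (q' t))"
proof -
  define s where "s t = (norm (g t))\<^sup>2" for t
  \<comment> \<open>half the derivative of \<open>s\<close>\<close>
  define h where "h t = g t \<bullet> g' t" for t
  define w where "w t = cross3 (g t) (q t)" for t
  define w' where "w' t = cross3 (g t) (q' t) + cross3 (g' t) (q t)" for t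
  let ?C = "\<lambda>\<epsilon> t. cos_root (\<epsilon>\<^sup>2 * s t)"
  let ?S = "\<lambda>k \<epsilon> t. sinc_root_deriv k (\<epsilon>\<^sup>2 * s t)"
  define ut where "ut \<epsilon> t = (- \<epsilon>\<^sup>2 * h t * ?S 0 \<epsilon> t) *\<^sub>R q t + ?C \<epsilon> t *\<^sub>R q' t
      + (2 * \<epsilon> ^ 3 * h t * ?S 1 \<epsilon> t) *\<^sub>R w t + (\<epsilon> * ?S 0 \<epsilon> t) *\<^sub>R w' t" for \<epsilon> t
  define ue where "ue \<epsilon> t = (- \<epsilon> * s t * ?S 0 \<epsilon> t) *\<^sub>R q t
      + (?S 0 \<epsilon> t + 2 * \<epsilon>\<^sup>2 * s t * ?S 1 \<epsilon> t) *\<^sub>R w t" for \<epsilon> t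
  define uet where "uet \<epsilon> t =
      (- 2 * \<epsilon> * h t * ?S 0 \<epsilon> t - 2 * \<epsilon> ^ 3 * s t * h t * ?S 1 \<epsilon> t) *\<^sub>R q t
      + (- \<epsilon> * s t * ?S 0 \<epsilon> t) *\<^sub>R q' t
      + (6 * \<epsilon>\<^sup>2 * h t * ?S 1 \<epsilon> t + 4 * \<epsilon> ^ 4 * s t * h t * ?S 2 \<epsilon> t) *\<^sub>R w t
      + (?S 0 \<epsilon> t + 2 * \<epsilon>\<^sup>2 * s t * ?S 1 \<epsilon> t) *\<^sub>R w' t" for \<epsilon> t
  have u: "u \<epsilon> t = ?C \<epsilon> t *\<^sub>R q t + (\<epsilon> * ?S 0 \<epsilon> t) *\<^sub>R w t" if "t \<in> I" for \<epsilon> t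
    using matrix_exp_skew_mult_orthogonal[OF orth[OF that]] by (simp add: u_def s_def w_def)
  have ds: "(s has_real_derivative 2 * h t) (at t within I)" if "t \<in> I" for t
    using bounded_bilinear.has_vector_derivative[OF bounded_bilinear_inner g'[OF that] g'[OF that]]
    by (simp add: s_def[abs_def] h_def power2_norm_eq_inner inner_commute
        has_real_derivative_iff_has_vector_derivative)
  have dw: "(w has_vector_derivative w' t) (at t within I)" if "t \<in> I" for t
    unfolding w_def[abs_def] w'_def by (rule has_vector_derivative_cross3[OF g'[OF that] q'[OF that]])
  note dC = DERIV_chain2[OF cos_root_has_real_derivative]
    and dS = DERIV_chain2[OF sinc_root_deriv_has_real_derivative]
  have dCe: "((\<lambda>\<epsilon>. ?C \<epsilon> t) has_real_derivative - \<epsilon> * s t * ?S 0 \<epsilon> t) (at \<epsilon>)" for \<epsilon> t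
    by (rule dC[THEN DERIV_cong]) (auto intro!: derivative_eq_intros)
  have dSe: "((\<lambda>\<epsilon>. ?S k \<epsilon> t) has_real_derivative 2 * \<epsilon> * s t * ?S (Suc k) \<epsilon> t) (at \<epsilon>)" for k \<epsilon> t
    by (rule dS[THEN DERIV_cong]) (auto intro!: derivative_eq_intros)
  have dCt: "((\<lambda>t. ?C \<epsilon> t) has_real_derivative - \<epsilon>\<^sup>2 * h t * ?S 0 \<epsilon> t) (at t within I)"
    if "t \<in> I" for \<epsilon> t
    by (rule dC[THEN DERIV_cong]) (auto intro!: derivative_eq_intros ds that)
  have dSt: "((\<lambda>t. ?S k \<epsilon> t) has_real_derivative 2 * \<epsilon>\<^sup>2 * h t * ?S (Suc k) \<epsilon> t) (at t within I)"
    if "t \<in> I" for k \<epsilon> t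
    by (rule dS[THEN DERIV_cong]) (auto intro!: derivative_eq_intros ds that)
  have cont_s: "continuous_on I s" "continuous_on I h" "continuous_on I w" "continuous_on I w'"
    unfolding s_def[abs_def] h_def[abs_def] w_def[abs_def] w'_def[abs_def]
    by (intro continuous_intros continuous_on_cross cont)+
  have cont_snd: "continuous_on (UNIV \<times> I) (\<lambda>z :: real \<times> real. f (snd z))"
    if "continuous_on I f" for f :: "real \<Rightarrow> 'c :: topological_space"
    by (rule continuous_on_compose2[OF that]) (auto intro!: continuous_intros)
  have "continuous_on UNIV cos_root" "continuous_on UNIV (sinc_root_deriv k)" for k
    by (auto intro!: continuous_at_imp_continuous_on DERIV_isCont
        cos_root_has_real_derivative sinc_root_deriv_has_real_derivative)
  then have cont_entire: "continuous_on (UNIV \<times> I) (\<lambda>z. f ((fst z)\<^sup>2 * s (snd z)))"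
    if "f = cos_root \<or> (\<exists>k. f = sinc_root_deriv k)" for f
    using that by (intro continuous_on_compose2[of UNIV f "UNIV \<times> I"] continuous_intros cont_snd cont_s) auto
  have cont_CS: "continuous_on (UNIV \<times> I) (\<lambda>z. ?C (fst z) (snd z))"
      "continuous_on (UNIV \<times> I) (\<lambda>z. ?S k (fst z) (snd z))" for k
    by (rule cont_entire, blast)+
  note cont_intros = continuous_intros cont_CS cont_snd[OF cont_s(1)] cont_snd[OF cont_s(2)]
    cont_snd[OF cont_s(3)] cont_snd[OF cont_s(4)] cont_snd[OF cont(1)] cont_snd[OF cont(3)]
  have d1: "((\<lambda>s. u \<epsilon> s) has_vector_derivative ut \<epsilon> t) (at t within I)" if "t \<in> I" for \<epsilon> t
  proof (rule has_vector_derivative_transform[OF that u])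
    show "((\<lambda>t. ?C \<epsilon> t *\<^sub>R q t + (\<epsilon> * ?S 0 \<epsilon> t) *\<^sub>R w t) has_vector_derivative ut \<epsilon> t) (at t within I)"
      by (rule has_vector_derivative_eq_rhs, (rule derivative_intros dCt dSt q' dw that)+)
        (simp add: ut_def power2_eq_square power3_eq_cube mult_ac)
  qed
  have d2: "((\<lambda>\<epsilon>. u \<epsilon> t) has_vector_derivative ue \<epsilon> t) (at \<epsilon>)" if "t \<in> I" for \<epsilon> t
    unfolding u[OF that]
    by (rule has_vector_derivative_eq_rhs, (rule derivative_intros dCe dSe)+)
      (simp add: ue_def power2_eq_square algebra_simps)
  have d3: "((\<lambda>\<epsilon>. ut \<epsilon> t) has_vector_derivative uet \<epsilon> t) (at \<epsilon>)" if "t \<in> I" for \<epsilon> t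
    unfolding ut_def
    by (rule has_vector_derivative_eq_rhs, (rule derivative_intros dCe dSe)+)
      (simp add: uet_def power2_eq_square power3_eq_cube power4_eq_xxxx numeral_2_eq_2 algebra_simps)
  have "continuous_on (UNIV \<times> I) (\<lambda>z. ?C (fst z) (snd z) *\<^sub>R q (snd z)
      + (fst z * ?S 0 (fst z) (snd z)) *\<^sub>R w (snd z))"
    by (intro cont_intros)
  then have c1: "continuous_on (UNIV \<times> I) (\<lambda>(\<epsilon>, t). u \<epsilon> t)"
    by (rule continuous_on_eq) (auto simp: u)
  have c2: "continuous_on (UNIV \<times> I) (\<lambda>(\<epsilon>, t). ut \<epsilon> t)"
    unfolding ut_def split_beta by (intro cont_intros)
  have c3: "continuous_on (UNIV \<times> I) (\<lambda>(\<epsilon>, t). ue \<epsilon> t)"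
    unfolding ue_def split_beta by (intro cont_intros)
  have c4: "continuous_on (UNIV \<times> I) (\<lambda>(\<epsilon>, t). uet \<epsilon> t)"
    unfolding uet_def split_beta by (intro cont_intros)
  have "sinc_root_coeff 0 = sinc_root 0"
    using sinc_root_sums[of 0] unfolding powser_sums_zero_iff .
  then have at_0: "cos_root 0 = 1" "sinc_root 0 = 1"
    using cos_root_square[of 0] by (simp_all add: sinc_root_coeff_def)
  have "u 0 t = q t \<and> ut 0 t = q' t \<and> ue 0 t = cross3 (g t) (q t) \<and>
      uet 0 t = cross3 (g' t) (q t) + cross3 (g t) (q' t)" if "t \<in> I" for t
    using at_0 by (simp add: u[OF that] ut_def ue_def uet_def w_def w'_def add.commute)
  moreover have "C1_variation I u ut ue uet"
    unfolding C1_variation_def using d1 d2 d3 c1 c2 c3 c4 by simp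
  ultimately show ?thesis by blast
qed

section \<open>Gradients\<close>

text \<open>
  The derivative of a function at a point is a linear functional, represented by a unique vector; this
  is the vector that the description operator in \<open>gradient\<close> selects.
\<close>

lemma gradient_inner:
  fixes f :: "'a::euclidean_space \<Rightarrow> real"
  assumes "(f has_derivative D) (at x)"
  shows "h \<bullet> gradient f x = D h"
proof -
  have D: "D h = h \<bullet> adjoint D 1" for h
    using adjoint_works[OF has_derivative_linear[OF assms], of h 1] by simp
  then have "D = (\<lambda>h. h \<bullet> adjoint D 1)" by blast
  with assms have g: "GDERIV f x :> adjoint D 1" by (simp add: gderiv_def)
  moreover have "d = adjoint D 1" if "GDERIV f x :> d" for d
    using has_derivative_unique[OF that[unfolded gderiv_def] g[unfolded gderiv_def]]
    by (metis vector_eq_ldot)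
  ultimately have "gradient f x = adjoint D 1"
    unfolding gradient_def by (rule the_equality)
  then show ?thesis by (simp add: D)
qed

lemma vec_upd_has_derivative:
  "(vec_upd (q :: real^3^'n) i has_derivative axis i) (at x)"
proof -
  have "vec_upd q i = (\<lambda>x. axis i x + vec_upd q i 0)"
    by (auto simp: vec_upd_def axis_def vec_eq_iff)
  then show ?thesis
    using has_derivative_add_const[OF bounded_linear_imp_has_derivative[OF bounded_linear_axis]]
    by metis
qed

lemma vec_upd_same [simp]: "vec_upd q i (q $ i) = q"
  by (simp add: vec_upd_def vec_eq_iff)

lemma partial_gradients_inner:
  fixes L :: "(real^3^'n) \<times> (real^3^'n) \<Rightarrow> real"
  assumes "(L has_derivative D) (at (q, v))"
  shows grad_q_inner: "h \<bullet> grad_q L i q v = D (axis i h, 0)"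
    and grad_v_inner: "h \<bullet> grad_v L i q v = D (0, axis i h)"
proof -
  have "((\<lambda>x. (vec_upd q i x, v)) has_derivative (\<lambda>h. (axis i h, 0))) (at (q $ i))"
    by (intro has_derivative_Pair vec_upd_has_derivative has_derivative_const)
  from has_derivative_compose[OF this, of L D] assms
  show "h \<bullet> grad_q L i q v = D (axis i h, 0)"
    unfolding grad_q_def by (intro gradient_inner) simp
  have "((\<lambda>x. (q, vec_upd v i x)) has_derivative (\<lambda>h. (0, axis i h))) (at (v $ i))"
    by (intro has_derivative_Pair vec_upd_has_derivative has_derivative_const)
  from has_derivative_compose[OF this, of L D] assms
  show "h \<bullet> grad_v L i q v = D (0, axis i h)"
    unfolding grad_v_def by (intro gradient_inner) simp
qed

lemma derivative_eq_sum_gradients: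
  fixes L :: "(real^3^'n) \<times> (real^3^'n) \<Rightarrow> real"
  assumes "(L has_derivative D) (at (q, v))"
  shows "D (x, y) = (\<Sum>i\<in>UNIV. x $ i \<bullet> grad_q L i q v + y $ i \<bullet> grad_v L i q v)"
proof -
  have lin: "linear D" by (rule has_derivative_linear[OF assms])
  have "(x, y) = (\<Sum>i\<in>UNIV. (axis i (x $ i), 0) + (0, axis i (y $ i)))"
    by (simp add: prod_eq_iff fst_sum snd_sum sum_axis_eq)
  then have "D (x, y) = D (\<Sum>i\<in>UNIV. (axis i (x $ i), 0) + (0, axis i (y $ i)))"
    by simp
  also have "\<dots> = (\<Sum>i\<in>UNIV. D (axis i (x $ i), 0) + D (0, axis i (y $ i)))"
    unfolding linear_sum[OF lin] linear_add[OF lin] ..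
  finally show ?thesis by (simp add: partial_gradients_inner[OF assms])
qed

text \<open>
  In coordinates the partial gradients are values of the derivative of \<open>L\<close> on fixed vectors. That
  derivative is itself differentiable along the curve, which makes the momentum
  \<open>\<partial>L/\<partial>v\<^sub>i\<close> a \<open>C\<^sup>1\<close> curve; its time derivative in the Euler--Lagrange equations thus exists
  and is continuous.
\<close>

lemma gradients_along_curve:
  fixes L :: "(real^3^'n) \<times> (real^3^'n) \<Rightarrow> real"
  assumes "a < b" and "C2_on U L"
    and q: "C1_curve {a..b} q" and v: "C1_curve {a..b} v"
    and U: "\<And>t. t \<in> {a..b} \<Longrightarrow> (q t, v t) \<in> U"
  shows continuous_on_grad_q: "continuous_on {a..b} (\<lambda>t. grad_q L i (q t) (v t))"
    and C1_curve_grad_v: "C1_curve {a..b} (\<lambda>t. grad_v L i (q t) (v t))"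
proof -
  obtain DL D2L where
    DL: "\<And>x. x \<in> U \<Longrightarrow> (L has_derivative blinfun_apply (DL x)) (at x)" and
    D2L: "\<And>x. x \<in> U \<Longrightarrow> (DL has_derivative blinfun_apply (D2L x)) (at x)" and
    cont: "continuous_on U D2L"
    using \<open>C2_on U L\<close> unfolding C2_on_def by blast
  define z where "z t = (q t, v t)" for t
  define z' where "z' t = (ddt {a..b} q t, ddt {a..b} v t)" for t
  have z': "(z has_vector_derivative z' t) (at t within {a..b})" if "t \<in> {a..b}" for t
    unfolding z_def[abs_def] z'_def
    by (intro has_vector_derivative_Pair C1_curve_derivative q v that)
  have zU: "z t \<in> U" if "t \<in> {a..b}" for t using U[OF that] by (simp add: z_def)
  have cont_z: "continuous_on {a..b} z"
    unfolding z_def[abs_def] by (intro continuous_intros C1_curve_continuous q v)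
  have cont_z': "continuous_on {a..b} z'"
    using q v unfolding z'_def[abs_def] C1_curve_def by (intro continuous_intros) auto
  have deriv: "((\<lambda>t. DL (z t)) has_vector_derivative D2L (z t) (z' t)) (at t within {a..b})"
    if "t \<in> {a..b}" for t
    using has_derivative_compose[OF z'[OF that, unfolded has_vector_derivative_def] D2L[OF zU[OF that]]]
    by (simp add: has_vector_derivative_def blinfun.scaleR_right)
  have cont_DLz: "continuous_on {a..b} (\<lambda>t. DL (z t))"
    using deriv has_vector_derivative_continuous continuous_on_eq_continuous_within by blast
  have cont_D2Lz: "continuous_on {a..b} (\<lambda>t. D2L (z t) (z' t))"
    by (intro continuous_intros continuous_on_compose2[OF cont cont_z] cont_z') (use zU in auto)
  have rep: "x = (\<Sum>b\<in>Basis. (b \<bullet> x) *\<^sub>R b)" for x :: "real^3"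
    using euclidean_representation[of x, symmetric] by (simp only: inner_commute[of x])
  have "continuous_on {a..b} (\<lambda>t. \<Sum>b\<in>Basis. DL (z t) (axis i b, 0) *\<^sub>R b)"
    by (intro continuous_intros cont_DLz)
  then show "continuous_on {a..b} (\<lambda>t. grad_q L i (q t) (v t))"
  proof (rule continuous_on_eq)
    show "(\<Sum>b\<in>Basis. DL (z t) (axis i b, 0) *\<^sub>R b) = grad_q L i (q t) (v t)" if "t \<in> {a..b}" for t
      using rep[of "grad_q L i (q t) (v t)"] grad_q_inner[OF DL[OF U[OF that]]]
      by (simp add: z_def)
  qed
  show "C1_curve {a..b} (\<lambda>t. grad_v L i (q t) (v t))"
  proof (rule C1_curveI[OF \<open>a < b\<close>])
    show "continuous_on {a..b} (\<lambda>t. \<Sum>b\<in>Basis. D2L (z t) (z' t) (0, axis i b) *\<^sub>R b)"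
      by (intro continuous_intros cont_D2Lz)
    show "((\<lambda>t. grad_v L i (q t) (v t)) has_vector_derivative
        (\<Sum>b\<in>Basis. D2L (z t) (z' t) (0, axis i b) *\<^sub>R b)) (at t within {a..b})"
      if t: "t \<in> {a..b}" for t
    proof (rule has_vector_derivative_transform[OF t])
      show "grad_v L i (q t) (v t) = (\<Sum>b\<in>Basis. DL (z t) (0, axis i b) *\<^sub>R b)" if "t \<in> {a..b}" for t
        using rep[of "grad_v L i (q t) (v t)"] grad_v_inner[OF DL[OF U[OF that]]]
        by (simp add: z_def)
      have "bounded_linear (\<lambda>A. blinfun_apply A (0, axis i b) *\<^sub>R b)"
        for b :: "real^3"
        by (intro bounded_linear_intros)
      from bounded_linear.has_vector_derivative[OF this deriv[OF t]]
      show "((\<lambda>t. \<Sum>b\<in>Basis. DL (z t) (0, axis i b) *\<^sub>R b) has_vector_derivative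
          (\<Sum>b\<in>Basis. D2L (z t) (z' t) (0, axis i b) *\<^sub>R b)) (at t within {a..b})"
        by (intro has_vector_derivative_sum)
    qed
  qed
qed

section \<open>The first variation of the action\<close>

lemma leibniz_rule_composition:
  fixes F :: "'a::real_normed_vector \<Rightarrow> real" and z :: "real \<Rightarrow> real \<Rightarrow> 'a"
  assumes DF: "\<And>x. x \<in> U \<Longrightarrow> (F has_derivative blinfun_apply (DF x)) (at x)"
    and cont: "continuous_on U DF"
    and U: "\<And>\<epsilon> t. t \<in> {a..b} \<Longrightarrow> z \<epsilon> t \<in> U"
    and deriv: "\<And>\<epsilon> t. t \<in> {a..b} \<Longrightarrow> ((\<lambda>\<epsilon>. z \<epsilon> t) has_vector_derivative ze \<epsilon> t) (at \<epsilon>)"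
    and cont_z: "continuous_on (UNIV \<times> {a..b}) (\<lambda>(\<epsilon>, t). z \<epsilon> t)"
    and cont_ze: "continuous_on (UNIV \<times> {a..b}) (\<lambda>(\<epsilon>, t). ze \<epsilon> t)"
  shows "((\<lambda>\<epsilon>. integral {a..b} (\<lambda>t. F (z \<epsilon> t))) has_real_derivative
    integral {a..b} (\<lambda>t. DF (z \<epsilon> t) (ze \<epsilon> t))) (at \<epsilon>)"
proof -
  have "((\<lambda>\<epsilon>. integral (cbox a b) (\<lambda>t. F (z \<epsilon> t))) has_real_derivative
    integral (cbox a b) (\<lambda>t. DF (z \<epsilon> t) (ze \<epsilon> t))) (at \<epsilon> within UNIV)"
  proof (rule leibniz_rule_field_derivative)
    show "((\<lambda>\<epsilon>. F (z \<epsilon> t)) has_real_derivative DF (z \<epsilon> t) (ze \<epsilon> t)) (at \<epsilon> within UNIV)"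
      if "t \<in> cbox a b" for \<epsilon> t
    proof -
      have t: "t \<in> {a..b}" using that by (simp add: box_real)
      show ?thesis
        using has_derivative_compose[OF deriv[OF t, unfolded has_vector_derivative_def] DF[OF U[OF t]]]
        by (simp add: has_field_derivative_def blinfun.scaleR_right mult_commute_abs)
    qed
    have "continuous_on U F"
      using DF has_derivative_continuous continuous_at_imp_continuous_on by blast
    moreover have "continuous_on {a..b} (\<lambda>t. z \<epsilon> t)" for \<epsilon>
      by (rule continuous_on_compose2[OF cont_z, where f = "Pair \<epsilon>", simplified])
        (auto intro!: continuous_intros)
    ultimately show "(\<lambda>t. F (z \<epsilon> t)) integrable_on cbox a b" for \<epsilon>
      using U by (auto intro!: integrable_continuous_real continuous_on_compose2[of U F])
    show "continuous_on (UNIV \<times> cbox a b) (\<lambda>(\<epsilon>, t). DF (z \<epsilon> t) (ze \<epsilon> t))"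
      using U cont_z cont_ze unfolding split_beta
      by (auto intro!: continuous_intros continuous_on_compose2[OF cont])
  qed simp_all
  then show ?thesis by simp
qed

text \<open>
  The infinitesimal variations are \<open>\<delta>q\<^sub>i = \<gamma>\<^sub>i \<times> q\<^sub>i\<close> and
  \<open>\<delta>v\<^sub>i = \<gamma>\<^sub>i' \<times> q\<^sub>i + \<gamma>\<^sub>i \<times> q\<^sub>i'\<close>, collected from the single spheres.
\<close>

lemma variation_C1:
  fixes q \<gamma> :: "real \<Rightarrow> real^3^'n"
  assumes q: "C1_curve {t0..tf} q" and adm: "admissible t0 tf q \<gamma>"
  obtains ut ue uet where
    "C1_variation {t0..tf} (variation q \<gamma>) ut ue uet"
    "\<And>t. t \<in> {t0..tf} \<Longrightarrow> variation q \<gamma> 0 t = q t"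
    "\<And>t. t \<in> {t0..tf} \<Longrightarrow> ut 0 t = ddt {t0..tf} q t"
    "\<And>t i. t \<in> {t0..tf} \<Longrightarrow> ue 0 t $ i = cross3 (\<gamma> t $ i) (q t $ i)"
    "\<And>t i. t \<in> {t0..tf} \<Longrightarrow> uet 0 t $ i
      = cross3 (ddt {t0..tf} \<gamma> t $ i) (q t $ i) + cross3 (\<gamma> t $ i) (ddt {t0..tf} q t $ i)"
proof -
  let ?I = "{t0..tf}"
  have g: "C1_curve ?I \<gamma>" and orth: "\<And>t i. t \<in> ?I \<Longrightarrow> \<gamma> t $ i \<bullet> q t $ i = 0"
    using adm by (auto simp: admissible_def)
  \<comment> \<open>an opaque predicate lets the families for the single spheres be chosen all at once\<close>
  define P where "P i ut ue uet \<longleftrightarrow> C1_variation ?I (\<lambda>\<epsilon> t. variation q \<gamma> \<epsilon> t $ i) ut ue uet \<and>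
      (\<forall>t\<in>?I. variation q \<gamma> 0 t $ i = q t $ i \<and> ut 0 t = ddt ?I q t $ i \<and>
        ue 0 t = cross3 (\<gamma> t $ i) (q t $ i) \<and> uet 0 t
          = cross3 (ddt ?I \<gamma> t $ i) (q t $ i) + cross3 (\<gamma> t $ i) (ddt ?I q t $ i))" for i ut ue uet
  have "\<exists>ut ue uet. P i ut ue uet" for i
  proof -
    have cont: "continuous_on ?I (\<lambda>t. c t $ i)" "continuous_on ?I (\<lambda>t. ddt ?I c t $ i)"
      if "C1_curve ?I c" for c :: "real \<Rightarrow> real^3^'n"
      using C1_curve_continuous[OF that] that unfolding C1_curve_def
      by (auto intro!: continuous_intros)
    show ?thesis
      unfolding P_def variation_def vec_lambda_beta
      by (rule rotation_variation) (use orth C1_curve_component_derivative q g cont in blast)+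
  qed
  then obtain UT UE UET where P: "\<And>i. P i (UT i) (UE i) (UET i)" by metis
  show thesis
  proof (rule that[of "\<lambda>\<epsilon> t. \<chi> i. UT i \<epsilon> t" "\<lambda>\<epsilon> t. \<chi> i. UE i \<epsilon> t" "\<lambda>\<epsilon> t. \<chi> i. UET i \<epsilon> t"])
    show "C1_variation ?I (variation q \<gamma>)
        (\<lambda>\<epsilon> t. \<chi> i. UT i \<epsilon> t) (\<lambda>\<epsilon> t. \<chi> i. UE i \<epsilon> t) (\<lambda>\<epsilon> t. \<chi> i. UET i \<epsilon> t)"
      by (rule C1_variation_vec) (use P in \<open>simp add: P_def\<close>)
  qed (use P in \<open>simp_all add: P_def vec_eq_iff\<close>)
qed

lemma variation_in_spheres:
  assumes "admissible t0 tf q \<gamma>" and "t \<in> {t0..tf}" and "q t \<in> spheres"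
  shows "variation q \<gamma> \<epsilon> t \<in> spheres"
  using assms by (auto simp: spheres_def variation_def admissible_def intro!: norm_rotation)

text \<open>
  Differentiation under the integral gives \<open>\<integral> \<Sum>\<^sub>i \<partial>L/\<partial>q\<^sub>i \<bullet> \<delta>q\<^sub>i + \<partial>L/\<partial>v\<^sub>i \<bullet> \<delta>v\<^sub>i\<close>. As \<open>\<delta>v\<^sub>i\<close> is the time
  derivative of \<open>\<delta>q\<^sub>i\<close> and \<open>\<delta>q\<^sub>i\<close> vanishes at both ends, integration by parts moves the derivative
  to the momentum.
\<close>

lemma first_variation:
  fixes L :: "(real^3^'n) \<times> (real^3^'n) \<Rightarrow> real" and q \<gamma> :: "real \<Rightarrow> real^3^'n"
  assumes "t0 < tf" and "tangent_spheres \<subseteq> U" and "C2_on U L"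
    and q: "C2_curve {t0..tf} q" and sphere: "\<forall>t\<in>{t0..tf}. q t \<in> spheres"
    and adm: "admissible t0 tf q \<gamma>"
  defines "q' \<equiv> ddt {t0..tf} q"
  shows "((\<lambda>\<epsilon>. action t0 tf L (variation q \<gamma> \<epsilon>)) has_real_derivative
    - integral {t0..tf} (\<lambda>t. \<Sum>i\<in>UNIV.
        (ddt {t0..tf} (\<lambda>s. grad_v L i (q s) (q' s)) t - grad_q L i (q t) (q' t))
        \<bullet> cross3 (\<gamma> t $ i) (q t $ i))) (at 0)"
proof -
  let ?I = "{t0..tf}"
  let ?P = "\<lambda>i t. grad_v L i (q t) (q' t)" and ?Q = "\<lambda>i t. grad_q L i (q t) (q' t)"
  let ?w = "\<lambda>i t. cross3 (\<gamma> t $ i) (q t $ i)"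
  let ?w' = "\<lambda>i t. cross3 (ddt ?I \<gamma> t $ i) (q t $ i) + cross3 (\<gamma> t $ i) (q' t $ i)"
  have C1: "C1_curve ?I q" "C1_curve ?I q'" "C1_curve ?I \<gamma>"
    using q adm by (simp_all add: C2_curve_def q'_def admissible_def)
  obtain DL D2L where
    DL: "\<And>x. x \<in> U \<Longrightarrow> (L has_derivative blinfun_apply (DL x)) (at x)" and
    D2L: "\<And>x. x \<in> U \<Longrightarrow> (DL has_derivative blinfun_apply (D2L x)) (at x)"
    using \<open>C2_on U L\<close> unfolding C2_on_def by blast
  have cont_DL: "continuous_on U DL"
    using D2L has_derivative_continuous continuous_at_imp_continuous_on by blast
  obtain ut ue uet where var: "C1_variation ?I (variation q \<gamma>) ut ue uet"
    and at_0: "\<And>t. t \<in> ?I \<Longrightarrow> variation q \<gamma> 0 t = q t" "\<And>t. t \<in> ?I \<Longrightarrow> ut 0 t = q' t"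
      "\<And>t i. t \<in> ?I \<Longrightarrow> ue 0 t $ i = ?w i t" "\<And>t i. t \<in> ?I \<Longrightarrow> uet 0 t $ i = ?w' i t"
    using variation_C1[OF C1(1) adm] unfolding q'_def by metis
  have U: "(variation q \<gamma> \<epsilon> t, ut \<epsilon> t) \<in> U" if "t \<in> ?I" for \<epsilon> t
  proof -
    have "(variation q \<gamma> \<epsilon> t, ut \<epsilon> t) \<in> tangent_spheres"
      by (rule tangent_spheresI[OF \<open>t0 < tf\<close> _ _ that])
        (use var that sphere variation_in_spheres[OF adm] in \<open>auto simp: C1_variation_def\<close>)
    then show ?thesis using assms(2) by blast
  qed
  have qU: "(q t, q' t) \<in> U" if "t \<in> ?I" for t
    using U[OF that, of 0] at_0 that by simp
  have "ddt ?I (variation q \<gamma> \<epsilon>) t = ut \<epsilon> t" if "t \<in> ?I" for \<epsilon> t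
    by (rule ddt_eqI[OF \<open>t0 < tf\<close> that]) (use var that in \<open>auto simp: C1_variation_def\<close>)
  then have action: "action t0 tf L (variation q \<gamma> \<epsilon>)
      = integral ?I (\<lambda>t. L (variation q \<gamma> \<epsilon> t, ut \<epsilon> t))" for \<epsilon>
    unfolding action_def by (intro integral_cong) simp
  have "((\<lambda>\<epsilon>. action t0 tf L (variation q \<gamma> \<epsilon>)) has_real_derivative
      integral ?I (\<lambda>t. DL (variation q \<gamma> 0 t, ut 0 t) (ue 0 t, uet 0 t))) (at 0)"
    unfolding action
  proof (rule leibniz_rule_composition[OF DL cont_DL U])
    show "((\<lambda>\<epsilon>. (variation q \<gamma> \<epsilon> t, ut \<epsilon> t)) has_vector_derivative (ue \<epsilon> t, uet \<epsilon> t)) (at \<epsilon>)"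
      if "t \<in> ?I" for \<epsilon> t
      using var that by (intro has_vector_derivative_Pair) (auto simp: C1_variation_def)
    show "continuous_on (UNIV \<times> ?I) (\<lambda>(\<epsilon>, t). (variation q \<gamma> \<epsilon> t, ut \<epsilon> t))"
      "continuous_on (UNIV \<times> ?I) (\<lambda>(\<epsilon>, t). (ue \<epsilon> t, uet \<epsilon> t))"
      using var unfolding C1_variation_def split_beta by (auto intro!: continuous_intros)
  qed
  also have "integral ?I (\<lambda>t. DL (variation q \<gamma> 0 t, ut 0 t) (ue 0 t, uet 0 t))
      = integral ?I (\<lambda>t. \<Sum>i\<in>UNIV. ?w i t \<bullet> ?Q i t + ?w' i t \<bullet> ?P i t)"
    by (rule integral_cong) (simp add: at_0 derivative_eq_sum_gradients[OF DL[OF qU]])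
  also have "\<dots> = - integral ?I (\<lambda>t. \<Sum>i\<in>UNIV. (ddt ?I (?P i) t - ?Q i t) \<bullet> ?w i t)"
  proof -
    have C1P: "C1_curve ?I (?P i)" and contQ: "continuous_on ?I (?Q i)" for i
      using gradients_along_curve[OF \<open>t0 < tf\<close> \<open>C2_on U L\<close> C1(1,2) qU] by auto
    have dw: "(?w i has_vector_derivative ?w' i t) (at t within ?I)" if "t \<in> ?I" for i t
      using has_vector_derivative_cross3[OF C1_curve_component_derivative[OF C1(3) that]
          C1_curve_component_derivative[OF C1(1) that]]
      by (simp add: q'_def add.commute)
    have contw: "continuous_on ?I (?w i)" for i
      using dw has_vector_derivative_continuous continuous_on_eq_continuous_within by blast
    have contw': "continuous_on ?I (?w' i)" for i
      using C1 C1_curve_continuous[OF C1(1)] C1_curve_continuous[OF C1(2)] C1_curve_continuous[OF C1(3)]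
      unfolding C1_curve_def by (intro continuous_intros continuous_on_cross) auto
    have contP: "continuous_on ?I (?P i)" "continuous_on ?I (ddt ?I (?P i))" for i
      using C1P[of i] C1_curve_continuous[OF C1P] by (simp_all add: C1_curve_def)
    have "((\<lambda>t. \<Sum>i\<in>UNIV. ?w i t \<bullet> ddt ?I (?P i) t + ?w' i t \<bullet> ?P i t) has_integral
        (\<Sum>i\<in>UNIV. ?w i tf \<bullet> ?P i tf) - (\<Sum>i\<in>UNIV. ?w i t0 \<bullet> ?P i t0)) ?I"
      using \<open>t0 < tf\<close>
      by (intro fundamental_theorem_of_calculus has_vector_derivative_sum
          bounded_bilinear.has_vector_derivative[OF bounded_bilinear_inner] dw C1_curve_derivative C1P) auto
    moreover have "\<gamma> t0 = 0" "\<gamma> tf = 0" using adm by (simp_all add: admissible_def)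
    ultimately have parts:
      "integral ?I (\<lambda>t. \<Sum>i\<in>UNIV. ?w i t \<bullet> ddt ?I (?P i) t + ?w' i t \<bullet> ?P i t) = 0"
      by (simp add: integral_unique)
    have "integral ?I (\<lambda>t. \<Sum>i\<in>UNIV. ?w i t \<bullet> ?Q i t + ?w' i t \<bullet> ?P i t)
        = integral ?I (\<lambda>t. (\<Sum>i\<in>UNIV. ?w i t \<bullet> ddt ?I (?P i) t + ?w' i t \<bullet> ?P i t)
            - (\<Sum>i\<in>UNIV. (ddt ?I (?P i) t - ?Q i t) \<bullet> ?w i t))"
      by (rule integral_cong)
        (simp add: sum_subtractf[symmetric] inner_diff_left inner_diff_right inner_commute add.commute)
    also have "\<dots> = integral ?I (\<lambda>t. \<Sum>i\<in>UNIV. ?w i t \<bullet> ddt ?I (?P i) t + ?w' i t \<bullet> ?P i t)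
        - integral ?I (\<lambda>t. \<Sum>i\<in>UNIV. (ddt ?I (?P i) t - ?Q i t) \<bullet> ?w i t)"
      by (intro integral_diff integrable_continuous_real continuous_intros contw contw' contP contQ)
    finally show ?thesis by (simp add: parts)
  qed
  finally show ?thesis .
qed

section \<open>The Euler--Lagrange equations\<close>

text \<open>
  Du Bois-Reymond's choice of test function avoids bump functions. Let \<open>G\<close> be a primitive of \<open>g\<close>,
  \<open>m\<close> its mean value, and \<open>\<phi>\<close> the primitive of \<open>G - m\<close> that vanishes at \<open>a\<close>; it vanishes at \<open>b\<close> by
  the choice of \<open>m\<close>. Integrating by parts turns \<open>\<integral> \<phi> g = 0\<close> into \<open>\<integral> (G - m)\<^sup>2 = 0\<close>, so \<open>G\<close> is
  constant and its derivative \<open>g\<close> is zero.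
\<close>

lemma fundamental_lemma_of_variations:
  fixes g :: "real \<Rightarrow> real"
  assumes "a < b" and cont: "continuous_on {a..b} g"
    and orth: "\<And>\<phi>. C1_curve {a..b} \<phi> \<Longrightarrow> \<phi> a = 0 \<Longrightarrow> \<phi> b = 0 \<Longrightarrow>
      integral {a..b} (\<lambda>t. \<phi> t * g t) = 0"
    and "t \<in> {a..b}"
  shows "g t = 0"
proof -
  define G where "G u = integral {a..u} g" for u
  define m where "m = integral {a..b} G / (b - a)"
  define \<phi> where "\<phi> u = integral {a..u} (\<lambda>s. G s - m)" for u
  have dG: "(G has_vector_derivative g s) (at s within {a..b})" if "s \<in> {a..b}" for s
    unfolding G_def[abs_def] by (rule integral_has_vector_derivative[OF cont that])
  have contG: "continuous_on {a..b} G"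
    using dG has_vector_derivative_continuous continuous_on_eq_continuous_within by blast
  have d\<phi>: "(\<phi> has_vector_derivative G s - m) (at s within {a..b})" if "s \<in> {a..b}" for s
    unfolding \<phi>_def[abs_def]
    by (rule integral_has_vector_derivative[OF _ that]) (intro continuous_intros contG)
  have C1: "C1_curve {a..b} \<phi>"
    by (rule C1_curveI[OF \<open>a < b\<close> d\<phi>]) (auto intro!: continuous_intros contG)
  have ends: "\<phi> a = 0" "\<phi> b = 0"
    using \<open>a < b\<close> by (simp_all add: \<phi>_def m_def integral_diff integrable_continuous_real contG)
  have "((\<lambda>s. \<phi> s * g s + (G s - m) * (G s - m)) has_integral
      \<phi> b * (G b - m) - \<phi> a * (G a - m)) {a..b}"
    using \<open>a < b\<close>
    by (intro fundamental_theorem_of_calculus)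
      (auto intro!: derivative_eq_intros d\<phi> dG)
  then have "integral {a..b} (\<lambda>s. \<phi> s * g s + (G s - m)\<^sup>2) = 0"
    using ends by (simp add: power2_eq_square integral_unique)
  moreover have "integral {a..b} (\<lambda>s. \<phi> s * g s + (G s - m)\<^sup>2)
      = integral {a..b} (\<lambda>s. \<phi> s * g s) + integral {a..b} (\<lambda>s. (G s - m)\<^sup>2)"
    by (intro integral_add integrable_continuous_real continuous_intros
        C1_curve_continuous[OF C1] cont contG)
  ultimately have "integral {a..b} (\<lambda>s. (G s - m)\<^sup>2) = 0"
    using orth[OF C1 ends] by simp
  then have "G s = m" if "s \<in> {a..b}" for s
    using that \<open>a < b\<close> contG
    by (subst (asm) integral_eq_0_iff) (auto intro!: continuous_intros)
  then have "(G has_vector_derivative 0) (at t within {a..b})"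
    by (intro has_vector_derivative_transform[OF \<open>t \<in> {a..b}\<close> _ has_vector_derivative_const]) auto
  with dG \<open>t \<in> {a..b}\<close> \<open>a < b\<close> show "g t = 0"
    using vector_derivative_unique_within_closed_interval[of a b t G "g t" 0] by simp
qed

lemma tangential_projection:
  "(mat 1 - outer_square x) *v y = y - (x \<bullet> y) *\<^sub>R x"
proof -
  have "outer_square x *v y = (x \<bullet> y) *\<^sub>R x"
    by (simp add: outer_square_def vec_eq_iff matrix_vector_mult_def matrix_matrix_mult_def
        columnvector_def rowvector_def inner_vec_def sum_distrib_left mult_ac)
  then show ?thesis by (simp add: matrix_vector_mult_diff_rdistrib)
qed

text \<open>
  Both sides say that \<open>y\<close> is a multiple of the unit vector \<open>x\<close>. The cross product is the form in which
  the variational principle delivers the Euler--Lagrange equations.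
\<close>

lemma tangential_projection_eq_0_iff:
  assumes "norm x = 1"
  shows "(mat 1 - outer_square x) *v y = 0 \<longleftrightarrow> cross3 x y = 0"
proof -
  have xx: "x \<bullet> x = 1" using assms by (simp add: norm_eq_1)
  have "cross3 x (cross3 x y) = (x \<bullet> y) *\<^sub>R x - y"
    using Lagrange[of x x y] xx by simp
  moreover have "cross3 x (y - (x \<bullet> y) *\<^sub>R x) = cross3 x y"
    by (simp add: Cross3.right_diff_distrib cross_mult_right)
  ultimately show ?thesis
    unfolding tangential_projection by (metis cross_zero_right diff_0 minus_diff_eq minus_zero)
qed

text \<open>
  Test variations that move one sphere only. Projecting the fixed vector \<open>c\<close> onto the tangent plane
  at \<open>q t $ i\<close> makes the rotation axis orthogonal to \<open>q t $ i\<close>. The axis is \<open>C\<^sup>1\<close>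
  because \<open>\<phi>\<close> and \<open>q\<close> are; one built from the Euler--Lagrange expression, such as
  the vector product of \<open>q t $ i\<close> with it, would in general be only continuous.
\<close>

lemma admissible_single_sphere:
  fixes q :: "real \<Rightarrow> real^3^'n"
  assumes "a < b" and q: "C1_curve {a..b} q" and sphere: "\<forall>t\<in>{a..b}. q t \<in> spheres"
    and \<phi>: "C1_curve {a..b} \<phi>" "\<phi> a = 0" "\<phi> b = 0"
  shows "admissible a b q (\<lambda>t. axis i (\<phi> t *\<^sub>R (c - (q t $ i \<bullet> c) *\<^sub>R q t $ i)))"
proof -
  let ?p = "\<lambda>t. \<phi> t *\<^sub>R (c - (q t $ i \<bullet> c) *\<^sub>R q t $ i)"
  define p' where "p' t = \<phi> t *\<^sub>R (- ((q t $ i \<bullet> c) *\<^sub>R ddt {a..b} q t $ i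
        + (ddt {a..b} q t $ i \<bullet> c) *\<^sub>R q t $ i))
      + ddt {a..b} \<phi> t *\<^sub>R (c - (q t $ i \<bullet> c) *\<^sub>R q t $ i)" for t
  have dq: "((\<lambda>t. q t $ i) has_vector_derivative ddt {a..b} q t $ i) (at t within {a..b})"
    if "t \<in> {a..b}" for t
    by (rule C1_curve_component_derivative[OF q that])
  have dqc: "((\<lambda>t. q t $ i \<bullet> c) has_vector_derivative ddt {a..b} q t $ i \<bullet> c) (at t within {a..b})"
    if "t \<in> {a..b}" for t
    by (rule bounded_linear.has_vector_derivative[OF bounded_linear_inner_left dq[OF that]])
  have dp: "(?p has_vector_derivative p' t) (at t within {a..b})" if "t \<in> {a..b}" for t
    using bounded_bilinear.has_vector_derivative[OF bounded_bilinear_scaleR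
        C1_curve_derivative[OF \<phi>(1) that] has_vector_derivative_diff[OF has_vector_derivative_const[of c]
          bounded_bilinear.has_vector_derivative[OF bounded_bilinear_scaleR dqc[OF that] dq[OF that]]]]
    by (simp add: p'_def)
  have cont: "continuous_on {a..b} q" "continuous_on {a..b} (ddt {a..b} q)"
    "continuous_on {a..b} \<phi>" "continuous_on {a..b} (ddt {a..b} \<phi>)"
    using q \<phi>(1) C1_curve_continuous by (auto simp: C1_curve_def)
  have "C1_curve {a..b} (\<lambda>t. axis i (?p t) :: real^3^'n)"
  proof (rule C1_curveI[OF \<open>a < b\<close> bounded_linear.has_vector_derivative[OF bounded_linear_axis dp]])
    show "continuous_on {a..b} (\<lambda>t. axis i (p' t) :: real^3^'n)"
      unfolding p'_def
      by (intro bounded_linear.continuous_on[OF bounded_linear_axis] continuous_intros cont)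
  qed
  moreover have "axis i (?p t) $ j \<bullet> q t $ j = 0" if "t \<in> {a..b}" for t j
    using sphere that
    by (auto simp: axis_def spheres_def norm_eq_1 inner_diff_left inner_diff_right inner_commute)
  ultimately show ?thesis
    using \<phi>(2,3) by (simp add: admissible_def axis_def vec_eq_iff)
qed

theorem proposition1:
  fixes L :: "(real^3^'n) \<times> (real^3^'n) \<Rightarrow> real"
    and U :: "((real^3^'n) \<times> (real^3^'n)) set"
    and q f :: "real \<Rightarrow> real^3^'n"
    and t0 tf :: real
  assumes "t0 < tf"
    and "open U" and "tangent_spheres \<subseteq> U" and "C2_on U L"
    and "C2_curve {t0..tf} q" and "\<forall>t\<in>{t0..tf}. q t \<in> spheres"
    and "continuous_on {t0..tf} f"
  shows "lagrange_dalembert t0 tf L f q \<longleftrightarrow>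
    (\<forall>i. \<forall>t\<in>{t0..tf}.
       (mat 1 - outer_square (q t $ i)) *v
         (ddt {t0..tf} (\<lambda>s. grad_v L i (q s) (ddt {t0..tf} q s)) t
          - grad_q L i (q t) (ddt {t0..tf} q t) - f t $ i) = 0)"
proof -
  let ?I = "{t0..tf}"
  let ?w = "\<lambda>\<gamma> i t. cross3 (\<gamma> t $ i) (q t $ i)"
  define A where "A i t = ddt ?I (\<lambda>s. grad_v L i (q s) (ddt ?I q s)) t
    - grad_q L i (q t) (ddt ?I q t)" for i t
  define E where "E i t = A i t - f t $ i" for i t
  have C1: "C1_curve ?I q" "C1_curve ?I (ddt ?I q)"
    using assms(5) by (simp_all add: C2_curve_def)
  note cont_q = C1_curve_continuous[OF C1(1)]
  have U: "(q t, ddt ?I q t) \<in> U" if "t \<in> ?I" for t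
    using tangent_spheresI[OF \<open>t0 < tf\<close> _ C1_curve_derivative[OF C1(1) that] that] assms(3,6) by blast
  have cont_A: "continuous_on ?I (A i)" for i
    unfolding A_def[abs_def]
    using gradients_along_curve[OF \<open>t0 < tf\<close> \<open>C2_on U L\<close> C1 U, of i]
    by (auto simp: C1_curve_def intro!: continuous_intros)
  have cont_E: "continuous_on ?I (E i)" for i
    unfolding E_def[abs_def] by (intro continuous_intros cont_A assms(7))
  have weak: "((\<lambda>\<epsilon>. action t0 tf L (variation q \<gamma> \<epsilon>))
        has_real_derivative - virtual_work t0 tf f q \<gamma>) (at 0) \<longleftrightarrow>
      integral ?I (\<lambda>t. \<Sum>i\<in>UNIV. E i t \<bullet> ?w \<gamma> i t) = 0"
    if adm: "admissible t0 tf q \<gamma>" for \<gamma>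
  proof -
    have cont_g: "continuous_on ?I \<gamma>"
      using adm C1_curve_continuous by (auto simp: admissible_def)
    have vw: "virtual_work t0 tf f q \<gamma> = integral ?I (\<lambda>t. \<Sum>i\<in>UNIV. f t $ i \<bullet> ?w \<gamma> i t)"
      by (simp add: virtual_work_def skew_mult_vec)
    have "integral ?I (\<lambda>t. \<Sum>i\<in>UNIV. E i t \<bullet> ?w \<gamma> i t)
        = integral ?I (\<lambda>t. (\<Sum>i\<in>UNIV. A i t \<bullet> ?w \<gamma> i t) - (\<Sum>i\<in>UNIV. f t $ i \<bullet> ?w \<gamma> i t))"
      by (simp add: E_def inner_diff_left sum_subtractf)
    also have "\<dots> = integral ?I (\<lambda>t. \<Sum>i\<in>UNIV. A i t \<bullet> ?w \<gamma> i t) - virtual_work t0 tf f q \<gamma>"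
      unfolding vw
      by (intro integral_diff integrable_continuous_real continuous_intros continuous_on_cross
          cont_A cont_q cont_g assms(7))
    finally show ?thesis
      using first_variation[OF assms(1,3,4,5,6) adm, folded A_def] DERIV_unique by fastforce
  qed
  have triple: "E i t \<bullet> ?w \<gamma> i t = \<gamma> t $ i \<bullet> cross3 (q t $ i) (E i t)" for \<gamma> i t
    by (simp add: cross3_simps)
  have "lagrange_dalembert t0 tf L f q \<longleftrightarrow> (\<forall>i. \<forall>t\<in>?I. cross3 (q t $ i) (E i t) = 0)"
  proof
    assume LdA: "lagrange_dalembert t0 tf L f q"
    show "\<forall>i. \<forall>t\<in>?I. cross3 (q t $ i) (E i t) = 0"
    proof (intro allI ballI)
      fix i t assume t: "t \<in> ?I"
      \<comment> \<open>a vector is zero once all its inner products vanish, so each fixed \<open>c\<close> gives a scalar problem\<close>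
      have "c \<bullet> cross3 (q t $ i) (E i t) = 0" for c
      proof (rule fundamental_lemma_of_variations[OF \<open>t0 < tf\<close> _ _ t])
        show "continuous_on ?I (\<lambda>t. c \<bullet> cross3 (q t $ i) (E i t))"
          by (intro continuous_intros continuous_on_cross cont_E cont_q)
        fix \<phi> assume \<phi>: "C1_curve ?I \<phi>" "\<phi> t0 = 0" "\<phi> tf = (0::real)"
        define \<gamma> where "\<gamma> t = (axis i (\<phi> t *\<^sub>R (c - (q t $ i \<bullet> c) *\<^sub>R q t $ i)) :: real^3^'n)" for t
        have adm: "admissible t0 tf q \<gamma>"
          unfolding \<gamma>_def by (rule admissible_single_sphere[OF \<open>t0 < tf\<close> C1(1) assms(6) \<phi>])
        \<comment> \<open>the projection drops out, since \<open>cross3 (q t $ i) (E i t)\<close> is orthogonal to \<open>q t $ i\<close>\<close>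
        have "E j t \<bullet> ?w \<gamma> j t = (if j = i then \<phi> t * (c \<bullet> cross3 (q t $ i) (E i t)) else 0)" for j t
          unfolding triple by (simp add: \<gamma>_def axis_def inner_diff_left dot_cross_self)
        then have "(\<Sum>j\<in>UNIV. E j t \<bullet> ?w \<gamma> j t) = \<phi> t * (c \<bullet> cross3 (q t $ i) (E i t))" for t
          by simp
        then show "integral ?I (\<lambda>t. \<phi> t * (c \<bullet> cross3 (q t $ i) (E i t))) = 0"
          using LdA weak[OF adm] adm by (simp add: lagrange_dalembert_def)
      qed
      then show "cross3 (q t $ i) (E i t) = 0" by (metis inner_eq_zero_iff)
    qed
  next
    assume "\<forall>i. \<forall>t\<in>?I. cross3 (q t $ i) (E i t) = 0"
    then have "integral ?I (\<lambda>t. \<Sum>i\<in>UNIV. E i t \<bullet> ?w \<gamma> i t) = integral ?I (\<lambda>t. 0)" for \<gamma>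
      unfolding triple by (intro integral_cong) simp
    then show "lagrange_dalembert t0 tf L f q"
      by (simp add: lagrange_dalembert_def weak)
  qed
  also have "\<dots> \<longleftrightarrow> (\<forall>i. \<forall>t\<in>?I. (mat 1 - outer_square (q t $ i)) *v E i t = 0)"
    using assms(6) by (auto simp: spheres_def tangential_projection_eq_0_iff)
  finally show ?thesis by (simp only: E_def A_def)
qed

end
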